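(* Let $\mathcal{A}$ be a Leibniz algebra over a field $F$ and let $B$, $C$ be any two subsets of $\mathcal{A}$. Then $f(B^n, C) \subseteq f^n(B, C)$ for all integers $n \geq 1$.
   Context: A Leibniz algebra over a field $F$ means a finite-dimensional left Leibniz algebra: a finite-dimensional $F$-vector space with a bilinear product $(x,y)\mapsto xy$ such that every left multiplication $L_x: y \mapsto xy$ is a derivation, i.e. $x(yz) = (xy)z + y(xz)$ for all $x,y,z$. For subsets $X, Y$ of $\mathcal{A}$, $XY$ denotes the linear span of all products $xy$ with $x \in X$, $y \in Y$. Powers are defined by $B^1 = B$ and $B^{n} = B B^{n-1}$ for $n \geq 2$. For subsets $B, C$ of $\mathcal{A}$, define $f(B,C) = BC + CB$, and define inductively $f^1(B,C) = f(B,C)$ and $f^{n+1}(B,C) = f(B, f^n(B,C))$ for $n \geq 1$. *)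

theory Defs
  imports Complex_Main "HOL-Library.Set_Algebras"
begin

locale leibniz_algebra = vector_space scale
  for scale :: "'f::field \<Rightarrow> 'a::ab_group_add \<Rightarrow> 'a"  (infixr \<open>*s\<close> 75) +
  fixes mult :: "'a \<Rightarrow> 'a \<Rightarrow> 'a"  (infixl \<open>\<cdot>\<close> 70)
  assumes finite_dim: "\<exists>S. finite S \<and> span S = UNIV"
    and linear_left_mult: "Vector_Spaces.linear scale scale (\<lambda>y. x \<cdot> y)"
    and linear_right_mult: "Vector_Spaces.linear scale scale (\<lambda>x. x \<cdot> y)"
    and left_leibniz: "x \<cdot> (y \<cdot> z) = (x \<cdot> y) \<cdot> z + y \<cdot> (x \<cdot> z)"
begin

definition set_mult :: "'a set \<Rightarrow> 'a set \<Rightarrow> 'a set"  (infixl \<open>\<odot>\<close> 70)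
  where "X \<odot> Y = span {x \<cdot> y | x y. x \<in> X \<and> y \<in> Y}"

text \<open>Powers are only meaningful for positive exponents; the value at 0 is a dummy.
  The first power of \<open>B\<close> is the set \<open>B\<close> itself, not its span.\<close>

fun set_power :: "'a set \<Rightarrow> nat \<Rightarrow> 'a set"
  where
    "set_power B 0 = {}"
  | "set_power B (Suc 0) = B"
  | "set_power B (Suc (Suc n)) = B \<odot> set_power B (Suc n)"

text \<open>Here \<open>+\<close> is the elementwise sum of sets, here the sum of two subspaces.\<close>

definition f :: "'a set \<Rightarrow> 'a set \<Rightarrow> 'a set"
  where "f B C = B \<odot> C + C \<odot> B"

text \<open>As for powers, the value at 0 is a dummy.\<close>

fun f_iter :: "nat \<Rightarrow> 'a set \<Rightarrow> 'a set \<Rightarrow> 'a set"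
  where
    "f_iter 0 B C = {}"
  | "f_iter (Suc 0) B C = f B C"
  | "f_iter (Suc (Suc n)) B C = f B (f_iter (Suc n) B C)"

end

end

theory Submission
  imports Defs
begin

text \<open>
  Induct on \<open>n\<close> with \<open>C\<close> arbitrary. For \<open>b \<in> B\<close>, \<open>p \<in> B\<^sup>n\<close>, \<open>c \<in> C\<close> the Leibniz identity gives
  \<open>(bp)c = b(pc) - p(bc)\<close> and \<open>c(bp) = (cb)p + b(cp)\<close>. The induction hypothesis for \<open>C\<close> puts
  \<open>pc\<close> and \<open>cp\<close> into \<open>f\<^sup>n(B,C)\<close>, and the induction hypothesis for \<open>f(B,C)\<close> puts \<open>p(bc)\<close> and
  \<open>(cb)p\<close> into \<open>f\<^sup>n(B,f(B,C)) = f\<^sup>n\<^sup>+\<^sup>1(B,C)\<close>.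
\<close>

context leibniz_algebra
begin

lemma subspace_vimage_mult_left:
  assumes "subspace S"
  shows "subspace {y. x \<cdot> y \<in> S}"
proof -
  interpret left: Vector_Spaces.linear scale scale "\<lambda>y. x \<cdot> y"
    by (rule linear_left_mult)
  show ?thesis
    using left.subspace_vimage[OF assms] by (simp add: vimage_def)
qed

lemma subspace_vimage_mult_right:
  assumes "subspace S"
  shows "subspace {x. x \<cdot> y \<in> S}"
proof -
  interpret right: Vector_Spaces.linear scale scale "\<lambda>x. x \<cdot> y"
    by (rule linear_right_mult)
  show ?thesis
    using right.subspace_vimage[OF assms] by (simp add: vimage_def)
qed

lemma subspace_f: "subspace (f X Y)"
proof -
  have "f X Y = {x + y |x y. x \<in> X \<odot> Y \<and> y \<in> Y \<odot> X}"
    by (auto simp: f_def set_plus_def)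
  then show ?thesis
    by (simp add: set_mult_def subspace_sums)
qed

lemma mult_in_f:
  assumes "x \<in> X" "y \<in> Y"
  shows "x \<cdot> y \<in> f X Y" "y \<cdot> x \<in> f X Y"
proof -
  have "x \<cdot> y \<in> X \<odot> Y" "y \<cdot> x \<in> Y \<odot> X"
    using assms by (auto simp: set_mult_def intro!: span_base)
  moreover have "0 \<in> X \<odot> Y" "0 \<in> Y \<odot> X"
    by (simp_all add: set_mult_def span_zero)
  ultimately show "x \<cdot> y \<in> f X Y" "y \<cdot> x \<in> f X Y"
    unfolding f_def
    using set_plus_intro[of "x \<cdot> y" "X \<odot> Y" 0 "Y \<odot> X"]
      set_plus_intro[of 0 "X \<odot> Y" "y \<cdot> x" "Y \<odot> X"]
    by simp_all
qed

lemma f_least: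
  assumes "subspace S"
    and "\<And>x y. x \<in> X \<Longrightarrow> y \<in> Y \<Longrightarrow> x \<cdot> y \<in> S"
    and "\<And>x y. x \<in> X \<Longrightarrow> y \<in> Y \<Longrightarrow> y \<cdot> x \<in> S"
  shows "f X Y \<subseteq> S"
proof -
  have "X \<odot> Y \<subseteq> S" "Y \<odot> X \<subseteq> S"
    unfolding set_mult_def using assms by (intro span_minimal; auto)+
  then show ?thesis
    using assms(1) by (auto simp: f_def elim!: set_plus_elim intro: subspace_add)
qed

text \<open>For fixed \<open>y\<close>, left and right multiplication by \<open>y\<close> are
  linear, so the elements they send into \<open>S\<close> form subspaces; each contains
  \<open>X\<close>, hence also \<open>span X\<close>.\<close>

lemma f_span_least:
  assumes "subspace S"
    and "\<And>x y. x \<in> X \<Longrightarrow> y \<in> Y \<Longrightarrow> x \<cdot> y \<in> S"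
    and "\<And>x y. x \<in> X \<Longrightarrow> y \<in> Y \<Longrightarrow> y \<cdot> x \<in> S"
  shows "f (span X) Y \<subseteq> S"
proof (rule f_least[OF assms(1)])
  fix x y assume "x \<in> span X" and y: "y \<in> Y"
  moreover have "span X \<subseteq> {x. x \<cdot> y \<in> S}"
    using y assms by (intro span_minimal subspace_vimage_mult_right) auto
  moreover have "span X \<subseteq> {x. y \<cdot> x \<in> S}"
    using y assms by (intro span_minimal subspace_vimage_mult_left) auto
  ultimately show "x \<cdot> y \<in> S" "y \<cdot> x \<in> S"
    by auto
qed

text \<open>The recursion adds factors on the outside. Exposing the innermost \<open>f B C\<close>
  instead lets an induction hypothesis taken at \<open>f B C\<close> end in the same target.\<close>

lemma f_iter_Suc_right: "f_iter (Suc n) B (f B C) = f_iter (Suc (Suc n)) B C"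
  by (induction n) auto

text \<open>The index is \<open>Suc n\<close> because the inclusion fails for the dummy values at 0:
  \<open>f {} C\<close> contains 0, while \<open>f_iter 0 B C\<close> is empty.\<close>

lemma f_set_power_subset: "f (set_power B (Suc n)) C \<subseteq> f_iter (Suc n) B C"
proof (induction n arbitrary: C)
  case 0
  show ?case by simp
next
  case (Suc n)
  let ?P = "set_power B (Suc n)" and ?S = "f_iter (Suc (Suc n)) B C"
  have S: "subspace ?S"
    by (simp add: subspace_f)
  \<comment> \<open>Here the hypothesis at \<open>C\<close> is used, and \<open>b\<close> supplies
    the outermost factor of \<open>?S\<close>.\<close>
  have outer: "b \<cdot> q \<in> ?S" if "b \<in> B" "q \<in> f ?P C" for b q
    using that Suc.IH[of C] mult_in_f(1)[of b B q "f_iter (Suc n) B C"] by auto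
  have inner: "p \<cdot> q \<in> ?S" "q \<cdot> p \<in> ?S" if "p \<in> ?P" "q \<in> f B C" for p q
    using that Suc.IH[of "f B C"] mult_in_f[of p ?P q "f B C"]
    unfolding f_iter_Suc_right by blast+
  have left: "(b \<cdot> p) \<cdot> c \<in> ?S" if "b \<in> B" "p \<in> ?P" "c \<in> C" for b p c
  proof -
    have "(b \<cdot> p) \<cdot> c = b \<cdot> (p \<cdot> c) - p \<cdot> (b \<cdot> c)"
      using left_leibniz[of b p c] by simp
    then show ?thesis
      using that by (metis S outer inner(1) mult_in_f(1) subspace_diff)
  qed
  have right: "c \<cdot> (b \<cdot> p) \<in> ?S" if "b \<in> B" "p \<in> ?P" "c \<in> C" for b p c
    unfolding left_leibniz[of c b p]
    using that by (intro subspace_add[OF S] outer inner(2) mult_in_f(2))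
  \<comment> \<open>The next power is the span of the products of \<open>b\<close> in
    \<open>B\<close> and \<open>p\<close> in \<open>?P\<close>, so \<open>left\<close> and
    \<open>right\<close> need only treat these generators.\<close>
  show ?case
    unfolding set_power.simps(3) set_mult_def
    using left right by (intro f_span_least[OF S]) auto
qed

end

theorem lemma2p1:
  fixes scale :: "'f::field \<Rightarrow> 'a::ab_group_add \<Rightarrow> 'a"
    and mult :: "'a \<Rightarrow> 'a \<Rightarrow> 'a"
    and B C :: "'a set"
    and n :: nat
  assumes "leibniz_algebra scale mult"
    and "n \<ge> 1"
  shows "leibniz_algebra.f scale mult (leibniz_algebra.set_power scale mult B n) C
       \<subseteq> leibniz_algebra.f_iter scale mult n B C"
proof -
  obtain m where "n = Suc m"
    using assms(2) by (cases n) auto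
  then show ?thesis
    using leibniz_algebra.f_set_power_subset[OF assms(1)] by simp
qed

end
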